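(* Let $V$ be an $N=1$ superconformal vertex algebra with a superconformal vector $G$, where $L$ is the corresponding conformal vector, with central charge $c$. Suppose that $v\in V$ is an odd vector satisfying $$[L\,{}_\lambda\,v]=\Big(\partial+\frac\lambda2\Big)v,\qquad[G\,{}_\lambda\,v]=G_{(0)}v+c_1\lambda,\qquad[v\,{}_\lambda\,v]=c_2$$ for some $c_1,c_2\in\mathbb{C}$, and that $(G_{(0)}v)_{(0)}$ is diagonalizable on $V$. Then the vector $G+\partial v$ is also a superconformal vector, and the corresponding conformal vector is $L+\frac12\partial G_{(0)}v$ with central charge $c+6c_1-3c_2$.
   Context: $V$ is a vertex (super)algebra over $\mathbb{C}$ with translation operator $\partial$ and $\lambda$-bracket $[a\,{}_\lambda\,b]=\sum_{m\ge0}\frac{\lambda^m}{m!}a_{(m)}b$; scalars are identified with multiples of the vacuum vector. A conformal vector of central charge $c$ is an even $L\in V$ with $[L\,{}_\lambda\,L]=(\partial+2\lambda)L+\frac c{12}\lambda^3$, $L_{(0)}=\partial$, and $L_{(1)}$ diagonalizable on $V$. A superconformal vector of central charge $c$ is an odd $G\in V$ such that $L=\frac12G_{(0)}G$ is a conformal vector (the corresponding conformal vector) and $[L\,{}_\lambda\,L]=(\partial+2\lambda)L+\frac c{12}\lambda^3$, $[L\,{}_\lambda\,G]=(\partial+\frac32\lambda)G$, $[G\,{}_\lambda\,G]=2L+\frac c3\lambda^2$. A vertex algebra with a superconformal vector is called an $N=1$ superconformal vertex algebra. *)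

theory Defs
  imports
    Complex_Main
    "HOL-Computational_Algebra.Polynomial"
    "HOL-Library.Groups_Big_Fun"
    "HOL-Library.Z2"
begin

class complex_vector = ab_group_add +
  fixes scaleC :: "complex \<Rightarrow> 'a \<Rightarrow> 'a"  (infixr "*\<^sub>C" 75)
  assumes scaleC_add_right: "a *\<^sub>C (x + y) = a *\<^sub>C x + a *\<^sub>C y"
    and scaleC_add_left: "(a + b) *\<^sub>C x = a *\<^sub>C x + b *\<^sub>C x"
    and scaleC_scaleC: "a *\<^sub>C (b *\<^sub>C x) = (a * b) *\<^sub>C x"
    and scaleC_one: "1 *\<^sub>C x = x"

global_interpretation cvec: vector_space "scaleC :: complex \<Rightarrow> 'a \<Rightarrow> 'a::complex_vector"
  by unfold_locales
    (simp_all add: scaleC_add_right scaleC_add_left scaleC_scaleC scaleC_one)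

definition diagonalizable :: "('a::complex_vector \<Rightarrow> 'a) \<Rightarrow> bool" where
  "diagonalizable f \<longleftrightarrow>
     (\<exists>B. cvec.independent B \<and> cvec.span B = UNIV \<and> (\<forall>b\<in>B. \<exists>\<mu>. f b = \<mu> *\<^sub>C b))"

definition koszul_sign :: "bit \<Rightarrow> bit \<Rightarrow> complex" where
  "koszul_sign p q = (if p * q = 1 then -1 else 1)"

text \<open>
  The whole type is the underlying space. Parities are elements of Z/2Z: \<open>homog 0\<close> is the
  even part and \<open>homog 1\<close> the odd part. \<open>a \<cdot>\<^bsub>n\<^esub> b\<close> is the \<open>n\<close>-th product, i.e. the mode
  \<open>a\<^bsub>(n)\<^esub>\<close> applied to \<open>b\<close>. All sums in the Borcherds identity have finite support by
  \<open>nprod_truncation\<close>.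
\<close>

class vertex_superalgebra = complex_vector +
  fixes homog :: "bit \<Rightarrow> 'a set"
    and vac :: 'a
    and nprod :: "'a \<Rightarrow> int \<Rightarrow> 'a \<Rightarrow> 'a"  ("(_ \<cdot>\<^bsub>_\<^esub> _)" [71, 0, 71] 70)
  assumes homog_zero: "0 \<in> homog p"
    and homog_add: "a \<in> homog p \<Longrightarrow> b \<in> homog p \<Longrightarrow> a + b \<in> homog p"
    and homog_scaleC: "a \<in> homog p \<Longrightarrow> z *\<^sub>C a \<in> homog p"
    and homog_Int: "homog 0 \<inter> homog 1 = {0}"
    and homog_sum: "\<exists>x\<in>homog 0. \<exists>y\<in>homog 1. a = x + y"
    and nprod_add_left: "(a + a') \<cdot>\<^bsub>n\<^esub> b = (a \<cdot>\<^bsub>n\<^esub> b) + (a' \<cdot>\<^bsub>n\<^esub> b)"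
    and nprod_add_right: "a \<cdot>\<^bsub>n\<^esub> (b + b') = (a \<cdot>\<^bsub>n\<^esub> b) + (a \<cdot>\<^bsub>n\<^esub> b')"
    and nprod_scaleC_left: "(z *\<^sub>C a) \<cdot>\<^bsub>n\<^esub> b = z *\<^sub>C (a \<cdot>\<^bsub>n\<^esub> b)"
    and nprod_scaleC_right: "a \<cdot>\<^bsub>n\<^esub> (z *\<^sub>C b) = z *\<^sub>C (a \<cdot>\<^bsub>n\<^esub> b)"
    and nprod_homog: "a \<in> homog p \<Longrightarrow> b \<in> homog q \<Longrightarrow> a \<cdot>\<^bsub>n\<^esub> b \<in> homog (p + q)"
    and nprod_truncation: "\<exists>N. \<forall>n\<ge>N. a \<cdot>\<^bsub>n\<^esub> b = 0"
    and vac_even: "vac \<in> homog 0"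
    and vac_nprod: "vac \<cdot>\<^bsub>n\<^esub> a = (if n = -1 then a else 0)"
    and nprod_vac_creation: "a \<cdot>\<^bsub>-1\<^esub> vac = a"
    and nprod_vac_nonneg: "n \<ge> 0 \<Longrightarrow> a \<cdot>\<^bsub>n\<^esub> vac = 0"
    and borcherds: "a \<in> homog p \<Longrightarrow> b \<in> homog q \<Longrightarrow>
      Sum_any (\<lambda>j::nat. ((of_int m :: complex) gchoose j) *\<^sub>C
        ((a \<cdot>\<^bsub>n + int j\<^esub> b) \<cdot>\<^bsub>m + k - int j\<^esub> c)) =
      Sum_any (\<lambda>j::nat. ((-1) ^ j * ((of_int n :: complex) gchoose j)) *\<^sub>C
        (a \<cdot>\<^bsub>m + n - int j\<^esub> (b \<cdot>\<^bsub>k + int j\<^esub> c)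
         - ((-1) powi n * koszul_sign p q) *\<^sub>C
             (b \<cdot>\<^bsub>n + k - int j\<^esub> (a \<cdot>\<^bsub>m + int j\<^esub> c))))"

definition translation :: "'a::vertex_superalgebra \<Rightarrow> 'a"  ("\<partial>") where
  "\<partial> a = a \<cdot>\<^bsub>-2\<^esub> vac"

text \<open>
  The \<open>\<lambda>\<close>-bracket is a polynomial in the formal variable \<open>\<lambda>\<close> with coefficients in the algebra;
  \<open>[:x\<^sub>0, x\<^sub>1, x\<^sub>2:]\<close> below stands for \<open>x\<^sub>0 + \<lambda> x\<^sub>1 + \<lambda>\<^sup>2 x\<^sub>2\<close>.
\<close>

definition lambda_bracket :: "'a::vertex_superalgebra \<Rightarrow> 'a \<Rightarrow> 'a poly" where
  "lambda_bracket a b = Sum_any (\<lambda>m. monom ((1 / fact m) *\<^sub>C (a \<cdot>\<^bsub>int m\<^esub> b)) m)"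

lemma coeff_lambda_bracket:
  "coeff (lambda_bracket a b) m = (1 / fact m) *\<^sub>C (a \<cdot>\<^bsub>int m\<^esub> b)"
proof -
  let ?t = "\<lambda>m. monom ((1 / fact m) *\<^sub>C (a \<cdot>\<^bsub>int m\<^esub> b)) m"
  obtain N where N: "\<And>n. n \<ge> N \<Longrightarrow> a \<cdot>\<^bsub>n\<^esub> b = 0"
    using nprod_truncation by blast
  have sub: "{m. ?t m \<noteq> 0} \<subseteq> {..nat N + m}"
  proof
    fix i assume i: "i \<in> {m. ?t m \<noteq> 0}"
    show "i \<in> {..nat N + m}"
    proof (rule ccontr)
      assume "i \<notin> {..nat N + m}"
      then have "int i \<ge> N" by simp
      then have "a \<cdot>\<^bsub>int i\<^esub> b = 0" by (rule N)
      then show False using i by simp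
    qed
  qed
  have "lambda_bracket a b = sum ?t {..nat N + m}"
    unfolding lambda_bracket_def by (rule Sum_any.expand_superset[OF _ sub]) simp
  then show ?thesis
    by (simp add: coeff_sum coeff_monom if_distrib sum.delta)
qed

definition conformal_vector :: "complex \<Rightarrow> 'a::vertex_superalgebra \<Rightarrow> bool" where
  "conformal_vector c L \<longleftrightarrow>
     L \<in> homog 0 \<and>
     lambda_bracket L L = [:\<partial> L, 2 *\<^sub>C L, 0, (c / 12) *\<^sub>C vac:] \<and>
     (\<forall>a. L \<cdot>\<^bsub>0\<^esub> a = \<partial> a) \<and>
     diagonalizable (\<lambda>a. L \<cdot>\<^bsub>1\<^esub> a)"

definition corresponding_conformal :: "'a::vertex_superalgebra \<Rightarrow> 'a" where
  "corresponding_conformal G = (1 / 2) *\<^sub>C (G \<cdot>\<^bsub>0\<^esub> G)"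

definition superconformal_vector :: "complex \<Rightarrow> 'a::vertex_superalgebra \<Rightarrow> bool" where
  "superconformal_vector c G \<longleftrightarrow>
     (let L = corresponding_conformal G in
       G \<in> homog 1 \<and>
       conformal_vector c L \<and>
       lambda_bracket L L = [:\<partial> L, 2 *\<^sub>C L, 0, (c / 12) *\<^sub>C vac:] \<and>
       lambda_bracket L G = [:\<partial> G, (3 / 2) *\<^sub>C G:] \<and>
       lambda_bracket G G = [:2 *\<^sub>C L, 0, (c / 3) *\<^sub>C vac:])"

end

theory Submission imports Defs begin

text \<open>
  Put \<open>J = G\<^sub>0 v\<close> and \<open>P(\<lambda>) = [v \<lambda> J]\<close>. The Jacobi identity for \<open>v, v, G\<close> reads
  \<open>P(\<lambda>) + P(\<mu>) = 0\<close>, so \<open>P = 0\<close>. Since \<open>G\<^sub>0\<^sup>2 = \<partial>\<close>, the remaining brackets are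
  \<open>[G \<lambda> J] = (\<partial> + \<lambda>) v\<close>, \<open>[J \<lambda> J] = c\<^sub>2 \<lambda>\<close> and \<open>[L \<lambda> J] = (\<partial> + \<lambda>) J + c\<^sub>1 \<lambda>\<^sup>2 / 2\<close>, and the
  superconformal relations follow by sesquilinearity. The first mode of \<open>L + \<partial> J / 2\<close> is
  \<open>L\<^sub>1 - J\<^sub>0 / 2\<close>, a difference of commuting diagonalizable operators.
\<close>

section \<open>Commuting diagonalizable endomorphisms\<close>

abbreviation clinear :: "('a::complex_vector \<Rightarrow> 'a) \<Rightarrow> bool" where
  "clinear \<equiv> Vector_Spaces.linear (*\<^sub>C) (*\<^sub>C)"

lemma clinearI:
  assumes "\<And>x y. f (x + y) = f x + f y" "\<And>z x. f (z *\<^sub>C x) = z *\<^sub>C f x"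
  shows "clinear f"
  using assms by unfold_locales

lemma clinear_module_hom: "clinear f \<Longrightarrow> module_hom (*\<^sub>C) (*\<^sub>C) f"
  by (rule Vector_Spaces.linear.axioms(3))

lemmas clinear_add = clinear_module_hom[THEN module_hom.add]
  and clinear_scaleC = clinear_module_hom[THEN module_hom.scale]
  and clinear_diff = clinear_module_hom[THEN module_hom.diff]
  and clinear_sum = clinear_module_hom[THEN module_hom.sum]
  and clinear_0 = clinear_module_hom[THEN module_hom.zero]

text \<open>A maximal independent set of eigenvectors is a basis as soon as the eigenvectors span.
  This form spares later arguments the choice of a basis.\<close>

lemma diagonalizable_iff_span_eigenvectors:
  "diagonalizable f \<longleftrightarrow> cvec.span {x. \<exists>\<mu>. f x = \<mu> *\<^sub>C x} = UNIV"
proof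
  assume "diagonalizable f"
  then obtain B where "cvec.span B = UNIV" "\<forall>b\<in>B. \<exists>\<mu>. f b = \<mu> *\<^sub>C b"
    unfolding diagonalizable_def by blast
  moreover from this have "B \<subseteq> {x. \<exists>\<mu>. f x = \<mu> *\<^sub>C x}"
    by blast
  ultimately show "cvec.span {x. \<exists>\<mu>. f x = \<mu> *\<^sub>C x} = UNIV"
    using cvec.span_mono by blast
next
  let ?E = "{x. \<exists>\<mu>. f x = \<mu> *\<^sub>C x}"
  assume E: "cvec.span ?E = UNIV"
  obtain B where B: "B \<subseteq> ?E" "cvec.independent B" "?E \<subseteq> cvec.span B"
    by (rule cvec.maximal_independent_subset)
  then have "cvec.span B = UNIV"
    using E cvec.span_mono[OF B(3)] by (auto simp: cvec.span_span)
  then show "diagonalizable f"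
    unfolding diagonalizable_def using B by blast
qed

text \<open>Independence of eigenspaces, with the eigenvalue itself as index. Applying g - \<mu>
  kills the \<mu>-component and rescales the others by the nonzero factors \<nu> - \<mu>, which
  drives the induction.\<close>

lemma sum_eigenvectors_eq_0:
  assumes "finite S" "clinear g"
    and "\<And>\<nu>. \<nu> \<in> S \<Longrightarrow> g (y \<nu>) = \<nu> *\<^sub>C y \<nu>" "(\<Sum>\<nu>\<in>S. y \<nu>) = 0"
  shows "\<forall>\<nu>\<in>S. y \<nu> = 0"
  using assms(1,3,4)
proof (induction S arbitrary: y rule: finite_induct)
  case empty
  then show ?case by simp
next
  case (insert \<mu> S)
  define w where "w \<nu> = (\<nu> - \<mu>) *\<^sub>C y \<nu>" for \<nu>
  have "(\<Sum>\<nu>\<in>S. w \<nu>) = (\<Sum>\<nu>\<in>insert \<mu> S. w \<nu>)"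
    using insert by (simp add: w_def)
  also have "\<dots> = g (\<Sum>\<nu>\<in>insert \<mu> S. y \<nu>) - \<mu> *\<^sub>C (\<Sum>\<nu>\<in>insert \<mu> S. y \<nu>)"
    unfolding clinear_sum[OF assms(2)] cvec.scale_sum_right sum_subtractf[symmetric] w_def
    by (rule sum.cong) (simp_all add: insert.prems cvec.scale_left_diff_distrib)
  also have "\<dots> = 0"
    unfolding insert.prems by (simp add: clinear_0[OF assms(2)])
  finally have sum_w: "(\<Sum>\<nu>\<in>S. w \<nu>) = 0" .
  have "\<forall>\<nu>\<in>S. w \<nu> = 0"
    by (rule insert.IH[OF _ sum_w])
      (simp add: w_def clinear_scaleC[OF assms(2)] insert.prems mult.commute)
  then have y0: "\<forall>\<nu>\<in>S. y \<nu> = 0"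
    using insert.hyps(2) by (auto simp: w_def)
  then have "y \<mu> = 0"
    using insert.prems(2) insert.hyps by simp
  with y0 show ?case by simp
qed

lemma diagonalizable_decompose:
  assumes "diagonalizable g" "clinear g"
  obtains S y where "finite S" "x = (\<Sum>\<nu>\<in>S. y \<nu>)" "\<And>\<nu>. g (y \<nu>) = \<nu> *\<^sub>C y \<nu>"
proof -
  have "x \<in> cvec.span {x. \<exists>\<mu>. g x = \<mu> *\<^sub>C x}"
    using assms(1) diagonalizable_iff_span_eigenvectors by blast
  then have "\<exists>S y. finite S \<and> x = (\<Sum>\<nu>\<in>S. y \<nu>) \<and> (\<forall>\<nu>. g (y \<nu>) = \<nu> *\<^sub>C y \<nu>)"
  proof (induction rule: cvec.span_induct_alt)
    case base
    show ?case
      by (rule exI[of _ "{}"], rule exI[of _ "\<lambda>_. 0"]) (simp add: clinear_0[OF assms(2)])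
  next
    case (step z e x)
    then obtain S y \<mu> where S: "finite S" "x = (\<Sum>\<nu>\<in>S. y \<nu>)" "\<forall>\<nu>. g (y \<nu>) = \<nu> *\<^sub>C y \<nu>"
      and e: "g e = \<mu> *\<^sub>C e" by blast
    \<comment> \<open>If \<mu> is already in \<open>S\<close>, the new vector merges with that
      component. Outside \<open>S\<close> the values of \<open>y\<close> are not part of
      \<open>x\<close>, so they are cut off; otherwise a stray \<open>y \<mu>\<close> would enter
      the sum.\<close>
    define w where "w \<nu> = (if \<nu> \<in> S then y \<nu> else 0) + (if \<nu> = \<mu> then z *\<^sub>C e else 0)" for \<nu>
    have "sum w (insert \<mu> S) = z *\<^sub>C e + x"
      unfolding w_def sum.distrib S(2) using S(1)
      by (simp add: sum.inter_restrict[symmetric] add.commute Int_absorb1 subset_insertI)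
    moreover have "g (w \<nu>) = \<nu> *\<^sub>C w \<nu>" for \<nu>
      using S(3) e by (simp add: w_def clinear_add[OF assms(2)] clinear_scaleC[OF assms(2)]
          clinear_0[OF assms(2)] cvec.scale_right_distrib mult.commute)
    ultimately show ?case
      using S(1) by (metis finite_insert)
  qed
  then show ?thesis
    using that by blast
qed

text \<open>Split an eigenvector of \<open>f\<close> into eigencomponents of \<open>g\<close>. Since
  \<open>f\<close> preserves the eigenspaces of \<open>g\<close>, each component is again an
  eigenvector of \<open>f\<close>, hence a joint one.\<close>

lemma diagonalizable_diff_commuting:
  assumes f: "clinear f" "diagonalizable f" and g: "clinear g" "diagonalizable g"
    and comm: "\<And>x. f (g x) = g (f x)"
  shows "diagonalizable (\<lambda>x. f x - z *\<^sub>C g x)"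
proof -
  let ?E = "{x. \<exists>\<mu>. f x - z *\<^sub>C g x = \<mu> *\<^sub>C x}"
  have "x \<in> cvec.span ?E" if "f x = \<mu> *\<^sub>C x" for x \<mu>
  proof -
    obtain S y where S: "finite S" "x = (\<Sum>\<nu>\<in>S. y \<nu>)" "\<And>\<nu>. g (y \<nu>) = \<nu> *\<^sub>C y \<nu>"
      using diagonalizable_decompose[OF g(2,1)] by blast
    \<comment> \<open>These vectors lie in distinct eigenspaces of \<open>g\<close> and add up to f
      x - \<mu> x = 0, so each of them vanishes.\<close>
    have "\<forall>\<nu>\<in>S. f (y \<nu>) - \<mu> *\<^sub>C y \<nu> = 0"
    proof (rule sum_eigenvectors_eq_0[OF S(1) g(1)])
      show "g (f (y \<nu>) - \<mu> *\<^sub>C y \<nu>) = \<nu> *\<^sub>C (f (y \<nu>) - \<mu> *\<^sub>C y \<nu>)" for \<nu>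
        by (simp add: clinear_diff[OF g(1)] clinear_scaleC[OF g(1)] comm[symmetric] S(3)
            clinear_scaleC[OF f(1)] cvec.scale_right_diff_distrib mult.commute)
      show "(\<Sum>\<nu>\<in>S. f (y \<nu>) - \<mu> *\<^sub>C y \<nu>) = 0"
        using that unfolding S(2)
        by (simp add: clinear_sum[OF f(1)] sum_subtractf cvec.scale_sum_right)
    qed
    then have "f (y \<nu>) - z *\<^sub>C g (y \<nu>) = (\<mu> - z * \<nu>) *\<^sub>C y \<nu>" if "\<nu> \<in> S" for \<nu>
      using that by (simp add: S(3) cvec.scale_left_diff_distrib)
    then show ?thesis
      unfolding S(2) by (intro cvec.span_sum cvec.span_base) blast
  qed
  then have "cvec.span {x. \<exists>\<mu>. f x = \<mu> *\<^sub>C x} \<subseteq> cvec.span ?E"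
    by (intro cvec.span_minimal cvec.subspace_span) blast
  then show ?thesis
    using f(2) unfolding diagonalizable_iff_span_eigenvectors by blast
qed

section \<open>Calculus of modes\<close>

lemma nprod_zero_left [simp]: "0 \<cdot>\<^bsub>n\<^esub> (b::'a::vertex_superalgebra) = 0"
  using nprod_scaleC_left[of 0 0 n b] by simp

lemma nprod_zero_right [simp]: "(a::'a::vertex_superalgebra) \<cdot>\<^bsub>n\<^esub> 0 = 0"
  using nprod_scaleC_right[of a n 0 0] by simp

lemma nprod_minus_right [simp]: "(a::'a::vertex_superalgebra) \<cdot>\<^bsub>n\<^esub> - b = - (a \<cdot>\<^bsub>n\<^esub> b)"
  using nprod_scaleC_right[of a n "-1" b] by simp

lemma clinear_nprod: "clinear (\<lambda>b::'a::vertex_superalgebra. a \<cdot>\<^bsub>n\<^esub> b)"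
  by (rule clinearI) (simp_all add: nprod_add_right nprod_scaleC_right)

lemma translation_add: "\<partial> (a + b) = \<partial> a + \<partial> (b::'a::vertex_superalgebra)"
  by (simp add: translation_def nprod_add_left)

lemma translation_scaleC: "\<partial> (z *\<^sub>C a) = z *\<^sub>C \<partial> (a::'a::vertex_superalgebra)"
  by (simp add: translation_def nprod_scaleC_left)

lemma translation_diff: "\<partial> (a - b) = \<partial> a - \<partial> (b::'a::vertex_superalgebra)"
  using translation_add[of "a - b" b] by (simp add: eq_diff_eq)

lemma translation_0 [simp]: "\<partial> (0::'a::vertex_superalgebra) = 0"
  by (simp add: translation_def)

lemma translation_vac [simp]: "\<partial> (vac::'a::vertex_superalgebra) = 0"
  by (simp add: translation_def vac_nprod)

lemma translation_homog: "a \<in> homog p \<Longrightarrow> \<partial> a \<in> homog p"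
  unfolding translation_def by (metis add_0_right nprod_homog vac_even)

text \<open>The Borcherds identity at n = 0: the binomials \<open>0 gchoose j\<close> leave only j =
  0 on the right, which is the supercommutator of modes.\<close>

lemma commutator_formula:
  fixes a b x :: "'a::vertex_superalgebra"
  assumes "a \<in> homog p" "b \<in> homog q" and N: "\<And>j. j > N \<Longrightarrow> a \<cdot>\<^bsub>int j\<^esub> b = 0"
  shows "(a \<cdot>\<^bsub>m\<^esub> (b \<cdot>\<^bsub>k\<^esub> x)) - koszul_sign p q *\<^sub>C (b \<cdot>\<^bsub>k\<^esub> (a \<cdot>\<^bsub>m\<^esub> x)) =
    (\<Sum>j\<le>N. (of_int m gchoose j) *\<^sub>C ((a \<cdot>\<^bsub>int j\<^esub> b) \<cdot>\<^bsub>m + k - int j\<^esub> x))"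
proof -
  let ?l = "\<lambda>j. ((of_int m :: complex) gchoose j) *\<^sub>C ((a \<cdot>\<^bsub>int j\<^esub> b) \<cdot>\<^bsub>m + k - int j\<^esub> x)"
  let ?r = "\<lambda>j::nat. ((-1) ^ j * ((of_int 0 :: complex) gchoose j)) *\<^sub>C
        ((a \<cdot>\<^bsub>m + 0 - int j\<^esub> (b \<cdot>\<^bsub>k + int j\<^esub> x))
         - ((-1) powi 0 * koszul_sign p q) *\<^sub>C
             (b \<cdot>\<^bsub>0 + k - int j\<^esub> (a \<cdot>\<^bsub>m + int j\<^esub> x)))"
  have "Sum_any ?l = Sum_any ?r"
    using borcherds[OF assms(1,2), of m 0 k x] by simp
  moreover have "Sum_any ?l = sum ?l {..N}"
    by (rule Sum_any.expand_superset) (use N in \<open>auto simp: linorder_not_less[symmetric]\<close>)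
  moreover have "Sum_any ?r = sum ?r {0}"
    by (rule Sum_any.expand_superset) (auto, metis gbinomial_0(2) not0_implies_Suc)
  ultimately show ?thesis by simp
qed

text \<open>The Borcherds identity speaks of homogeneous vectors only; this carries additive
  consequences over to all vectors.\<close>

lemma homog_induct:
  fixes a :: "'a::vertex_superalgebra"
  assumes "\<And>p x. x \<in> homog p \<Longrightarrow> P x" "\<And>x y. P x \<Longrightarrow> P y \<Longrightarrow> P (x + y)"
  shows "P a"
  using homog_sum[of a] assms by metis

text \<open>The Borcherds identity for \<open>a\<close> and \<open>vac\<close> with m = 0, n = -2.
  Only the mode -1 of \<open>vac\<close> is nonzero, so at most one term on the right
  survives.\<close>

lemma translation_nprod:
  "\<partial> a \<cdot>\<^bsub>n\<^esub> b = - (of_int n *\<^sub>C ((a::'a::vertex_superalgebra) \<cdot>\<^bsub>n - 1\<^esub> b))"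
proof (induction a rule: homog_induct)
  case (1 p a)
  let ?l = "\<lambda>j. ((of_int 0 :: complex) gchoose j) *\<^sub>C
      ((a \<cdot>\<^bsub>-2 + int j\<^esub> vac) \<cdot>\<^bsub>0 + n - int j\<^esub> b)"
  let ?r = "\<lambda>j::nat. ((-1) ^ j * ((of_int (-2) :: complex) gchoose j)) *\<^sub>C
      ((a \<cdot>\<^bsub>0 + -2 - int j\<^esub> (vac \<cdot>\<^bsub>n + int j\<^esub> b))
       - ((-1) powi (-2) * koszul_sign p 0) *\<^sub>C
           (vac \<cdot>\<^bsub>-2 + n - int j\<^esub> (a \<cdot>\<^bsub>0 + int j\<^esub> b)))"
  have "Sum_any ?l = Sum_any ?r"
    using borcherds[OF 1 vac_even, of 0 "-2" n b] by simp
  moreover have "Sum_any ?l = sum ?l {0}"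
    by (rule Sum_any.expand_superset) (auto, metis gbinomial_0(2) not0_implies_Suc)
  ultimately have lr: "\<partial> a \<cdot>\<^bsub>n\<^esub> b = Sum_any ?r"
    by (simp add: translation_def)
  have choose: "(-1) ^ j * ((-2 :: complex) gchoose j) = of_nat (Suc j)" for j
    using gbinomial_minus[of "2::complex" j] binomial_gbinomial[of "Suc j" j, where 'a=complex]
    by (simp add: add.commute power_mult_distrib[symmetric] mult.assoc[symmetric])
  \<comment> \<open>For n < 0 the survivor is in the first family, at j = -1 - n; for n > 0 it is in
    the second, at j = n - 1; for n = 0 there is none.\<close>
  consider "n < 0" | "n = 0" | "n > 0" by linarith
  then show ?case
  proof cases
    assume n: "n < 0"
    have "Sum_any ?r = sum ?r {nat (- 1 - n)}"
      by (rule Sum_any.expand_superset) (use n in \<open>auto simp: vac_nprod\<close>)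
    then show ?thesis
      using n by (simp add: lr choose vac_nprod)
  next
    assume n: "n = 0"
    have "Sum_any ?r = sum ?r {}"
      by (rule Sum_any.expand_superset) (auto simp: vac_nprod n)
    then have "\<partial> a \<cdot>\<^bsub>n\<^esub> b = 0"
      unfolding lr by (simp only: sum.empty)
    with n show ?thesis by simp
  next
    assume n: "n > 0"
    have "Sum_any ?r = sum ?r {nat (n - 1)}"
      by (rule Sum_any.expand_superset) (use n in \<open>auto simp: vac_nprod\<close>)
    then show ?thesis
      using n by (simp add: lr choose vac_nprod koszul_sign_def)
  qed
next
  case (2 x y)
  then show ?case
    by (simp add: translation_add nprod_add_left cvec.scale_right_distrib)
qed

text \<open>The Borcherds identity with m = -1, k = 0 on the vacuum. Creation and annihilation on
  \<open>vac\<close> leave a single term on the right, and the modes -1 - j applied to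
  \<open>vac\<close> are the divided powers of \<partial>.\<close>

lemma skew_symmetry:
  fixes a b :: "'a::vertex_superalgebra"
  assumes "a \<in> homog p" "b \<in> homog q" and N: "\<And>j. j > N \<Longrightarrow> a \<cdot>\<^bsub>n + int j\<^esub> b = 0"
  shows "b \<cdot>\<^bsub>n\<^esub> a = (- ((-1) powi n) * koszul_sign p q) *\<^sub>C
    (\<Sum>j\<le>N. ((-1) ^ j) *\<^sub>C ((a \<cdot>\<^bsub>n + int j\<^esub> b) \<cdot>\<^bsub>-1 - int j\<^esub> vac))"
proof -
  let ?l = "\<lambda>j. ((of_int (-1) :: complex) gchoose j) *\<^sub>C
      ((a \<cdot>\<^bsub>n + int j\<^esub> b) \<cdot>\<^bsub>-1 + 0 - int j\<^esub> vac)"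
  let ?r = "\<lambda>j::nat. ((-1) ^ j * ((of_int n :: complex) gchoose j)) *\<^sub>C
      ((a \<cdot>\<^bsub>-1 + n - int j\<^esub> (b \<cdot>\<^bsub>0 + int j\<^esub> vac))
       - ((-1) powi n * koszul_sign p q) *\<^sub>C
           (b \<cdot>\<^bsub>n + 0 - int j\<^esub> (a \<cdot>\<^bsub>-1 + int j\<^esub> vac)))"
  have "Sum_any ?l = Sum_any ?r"
    using borcherds[OF assms(1,2), of "-1" n 0 vac] by simp
  moreover have "Sum_any ?l = sum ?l {..N}"
    by (rule Sum_any.expand_superset) (use N in \<open>auto simp: linorder_not_less[symmetric]\<close>)
  moreover have "Sum_any ?r = sum ?r {0}"
  proof (rule Sum_any.expand_superset)
    have "j = 0" if "?r j \<noteq> 0" for j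
      using that by (cases j) (simp_all add: nprod_vac_nonneg)
    then show "{j. ?r j \<noteq> 0} \<subseteq> {0}" by blast
  qed simp
  moreover have "((-1::complex) gchoose j) = (-1) ^ j" for j
    using gbinomial_minus[of "1::complex" j] by (simp add: binomial_gbinomial[symmetric])
  \<comment> \<open>The sign is its own inverse, so it can be moved to the other side.\<close>
  moreover have "((-1) powi n * koszul_sign p q) * ((-1) powi n * koszul_sign p q) = 1"
    by (simp add: koszul_sign_def power_int_mult_distrib[symmetric])
  ultimately show ?thesis
    by (simp add: nprod_vac_nonneg nprod_vac_creation)
qed

text \<open>Commute mode \<open>n\<close> of \<open>a\<close> past mode -2 of \<open>b\<close> on
  \<open>vac\<close>, which the former annihilates; only the commutator remains.\<close>

lemma nprod_translation:
  fixes a b :: "'a::vertex_superalgebra"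
  shows "a \<cdot>\<^bsub>int n\<^esub> \<partial> b = \<partial> (a \<cdot>\<^bsub>int n\<^esub> b) + of_nat n *\<^sub>C (a \<cdot>\<^bsub>int n - 1\<^esub> b)"
proof (induction a rule: homog_induct)
  case (1 p a)
  show ?case
  proof (induction b rule: homog_induct)
    case b: (1 q b)
    obtain N where N: "\<And>k. k \<ge> N \<Longrightarrow> a \<cdot>\<^bsub>k\<^esub> b = 0"
      using nprod_truncation by blast
    let ?t = "\<lambda>j. (of_nat n gchoose j) *\<^sub>C ((a \<cdot>\<^bsub>int j\<^esub> b) \<cdot>\<^bsub>int n + -2 - int j\<^esub> vac)"
    have "a \<cdot>\<^bsub>int n\<^esub> \<partial> b = (\<Sum>j\<le>nat N + n. ?t j)"
      using commutator_formula[OF 1 b, of "nat N + n" "int n" "-2" vac] N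
      by (simp add: translation_def nprod_vac_nonneg)
    \<comment> \<open>For j > n the binomial is zero; for j \<le> n - 2 a nonnegative mode hits
      \<open>vac\<close>. At n = 0 truncated subtraction collapses the index set to {0}.\<close>
    also have "\<dots> = (\<Sum>j\<in>{n - 1, n}. ?t j)"
    proof (rule sum.mono_neutral_right)
      show "\<forall>j\<in>{..nat N + n} - {n - 1, n}. ?t j = 0"
      proof
        fix j assume "j \<in> {..nat N + n} - {n - 1, n}"
        then consider "j > n" | "int n + -2 - int j \<ge> 0" by force
        then show "?t j = 0"
          by cases (simp_all add: nprod_vac_nonneg binomial_gbinomial[symmetric])
      qed
    qed auto
    also have "\<dots> = \<partial> (a \<cdot>\<^bsub>int n\<^esub> b) + of_nat n *\<^sub>C (a \<cdot>\<^bsub>int n - 1\<^esub> b)"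
    proof (cases n)
      case (Suc k)
      have "(1 + of_nat k gchoose k) = (1 + of_nat k :: complex)"
        "(1 + of_nat k gchoose Suc k) = (1 :: complex)"
        using binomial_gbinomial[of "Suc k" k, where 'a=complex]
          binomial_gbinomial[of "Suc k" "Suc k", where 'a=complex] by simp_all
      with Suc show ?thesis
        by (simp add: translation_def nprod_vac_creation)
    qed (simp add: translation_def)
    finally show ?case .
  next
    case (2 x y)
    then show ?case
      by (simp add: translation_add nprod_add_right cvec.scale_right_distrib)
  qed
next
  case (2 x y)
  then show ?case
    by (simp add: translation_add nprod_add_left cvec.scale_right_distrib)
qed

section \<open>Calculus of brackets\<close>

lemma lambda_bracket_eq_iff:
  "lambda_bracket a b = P \<longleftrightarrow> (\<forall>m. a \<cdot>\<^bsub>int m\<^esub> b = fact m *\<^sub>C coeff P m)"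
proof -
  have "(1 / fact m) *\<^sub>C x = y \<longleftrightarrow> x = fact m *\<^sub>C y" for m and x y :: 'a
    by (auto simp: scaleC_scaleC)
  then show ?thesis
    by (simp add: poly_eq_iff coeff_lambda_bracket)
qed

lemma nprod_eq_coeff:
  "lambda_bracket a b = P \<Longrightarrow> n \<ge> 0 \<Longrightarrow> a \<cdot>\<^bsub>n\<^esub> b = fact (nat n) *\<^sub>C coeff P (nat n)"
  unfolding lambda_bracket_eq_iff by (metis int_nat_eq)

lemma lambda_bracket_eq_cubic_iff:
  "lambda_bracket a b = [:x\<^sub>0, x\<^sub>1, x\<^sub>2, x\<^sub>3:] \<longleftrightarrow>
    a \<cdot>\<^bsub>0\<^esub> b = x\<^sub>0 \<and> a \<cdot>\<^bsub>1\<^esub> b = x\<^sub>1 \<and> a \<cdot>\<^bsub>2\<^esub> b = 2 *\<^sub>C x\<^sub>2 \<and> a \<cdot>\<^bsub>3\<^esub> b = 6 *\<^sub>C x\<^sub>3 \<and>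
    (\<forall>n\<ge>4. a \<cdot>\<^bsub>int n\<^esub> b = 0)"
proof -
  have all: "(\<forall>m. Q m) \<longleftrightarrow> Q 0 \<and> Q 1 \<and> Q 2 \<and> Q 3 \<and> (\<forall>m\<ge>4. Q m)"
    for Q :: "nat \<Rightarrow> bool"
  proof safe
    fix m :: nat assume "Q 0" "Q 1" "Q 2" "Q 3" "\<forall>m\<ge>4. Q m"
    moreover have "m = 0 \<or> m = 1 \<or> m = 2 \<or> m = 3 \<or> m \<ge> 4" by arith
    ultimately show "Q m" by blast
  qed auto
  have "coeff [:x\<^sub>0, x\<^sub>1, x\<^sub>2, x\<^sub>3:] m = 0" if "m \<ge> 4" for m
    using that by (auto simp: coeff_pCons split: nat.split)
  then show ?thesis
    unfolding lambda_bracket_eq_iff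
    by (subst all) (simp add: fact_numeral eval_nat_numeral)
qed

lemma lambda_bracket_add_left:
  "lambda_bracket (a + a') b = lambda_bracket a b + lambda_bracket a' b"
  and lambda_bracket_add_right:
  "lambda_bracket a (b + b') = lambda_bracket a b + lambda_bracket a b'"
  by (simp_all add: poly_eq_iff coeff_lambda_bracket nprod_add_left nprod_add_right
      cvec.scale_right_distrib)

lemma lambda_bracket_scaleC_left:
  "lambda_bracket (z *\<^sub>C a) b = map_poly ((*\<^sub>C) z) (lambda_bracket a b)"
  and lambda_bracket_scaleC_right:
  "lambda_bracket a (z *\<^sub>C b) = map_poly ((*\<^sub>C) z) (lambda_bracket a b)"
  by (simp_all add: poly_eq_iff coeff_lambda_bracket coeff_map_poly nprod_scaleC_left
      nprod_scaleC_right mult.commute)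

text \<open>Left sesquilinearity: \<open>pCons 0\<close> is multiplication by \<lambda>, and the
  factor \<open>m\<close> from \<open>translation_nprod\<close> turns 1/m! into 1/(m-1)!.\<close>

lemma lambda_bracket_translation_left:
  "lambda_bracket (\<partial> a) b = - pCons 0 (lambda_bracket a b)"
proof -
  have "coeff (lambda_bracket (\<partial> a) b) m = coeff (- pCons 0 (lambda_bracket a b)) m" for m
  proof (cases m)
    case (Suc k)
    then show ?thesis
      using of_nat_neq_0[of k, where 'a=complex]
      by (simp add: coeff_lambda_bracket translation_nprod divide_simps)
  qed (simp add: coeff_lambda_bracket translation_nprod)
  then show ?thesis by (simp add: poly_eq_iff)
qed

text \<open>Right sesquilinearity, where \<open>map_poly \<partial>\<close> lets \<partial> act on
  the coefficients.\<close>

lemma lambda_bracket_translation_right: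
  "lambda_bracket a (\<partial> b) = map_poly \<partial> (lambda_bracket a b) + pCons 0 (lambda_bracket a b)"
proof -
  have "coeff (lambda_bracket a (\<partial> b)) m =
      coeff (map_poly \<partial> (lambda_bracket a b) + pCons 0 (lambda_bracket a b)) m" for m
  proof (cases m)
    case (Suc k)
    then show ?thesis
      using of_nat_neq_0[of k, where 'a=complex] nprod_translation[of a "Suc k" b]
      by (simp add: coeff_lambda_bracket coeff_map_poly translation_scaleC
          cvec.scale_right_distrib divide_simps)
  qed (use nprod_translation[of a 0 b] in
      \<open>simp add: coeff_lambda_bracket coeff_map_poly translation_scaleC\<close>)
  then show ?thesis by (simp add: poly_eq_iff)
qed

text \<open>Replace \<lambda> by -\<lambda> - \<partial>. As the top coefficient is a multiple of
  \<open>vac\<close>, which \<partial> kills, it contributes nothing to the lower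
  coefficients.\<close>

lemma lambda_bracket_skew_quadratic:
  assumes "a \<in> homog p" "b \<in> homog q" "lambda_bracket a b = [:x, y, z *\<^sub>C vac:]"
    and s: "s = - koszul_sign p q"
  shows "lambda_bracket b a = [:s *\<^sub>C (x - \<partial> y), - (s *\<^sub>C y), (s * z) *\<^sub>C vac:]"
proof -
  have ab: "a \<cdot>\<^bsub>0\<^esub> b = x" "a \<cdot>\<^bsub>1\<^esub> b = y" "a \<cdot>\<^bsub>2\<^esub> b = 2 *\<^sub>C z *\<^sub>C vac"
    by (simp_all add: nprod_eq_coeff[OF assms(3)] eval_nat_numeral)
  have ab0: "a \<cdot>\<^bsub>k\<^esub> b = 0" if "k \<ge> 3" for k
    using that by (auto simp: nprod_eq_coeff[OF assms(3)] coeff_pCons split: nat.split)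
  have skew: "b \<cdot>\<^bsub>n\<^esub> a = ((-1) powi n * s) *\<^sub>C
      (\<Sum>j\<le>2. ((-1) ^ j) *\<^sub>C ((a \<cdot>\<^bsub>n + int j\<^esub> b) \<cdot>\<^bsub>-1 - int j\<^esub> vac))" if "n \<ge> 0" for n
    by (subst skew_symmetry[OF assms(1,2), of 2]) (use ab0 that s in auto)
  have "b \<cdot>\<^bsub>n\<^esub> a = 0" if "n \<ge> 3" for n
    using that by (subst skew) (simp_all add: ab0)
  moreover have "b \<cdot>\<^bsub>0\<^esub> a = s *\<^sub>C (x - \<partial> y)" "b \<cdot>\<^bsub>1\<^esub> a = - (s *\<^sub>C y)"
    "b \<cdot>\<^bsub>2\<^esub> a = 2 *\<^sub>C (s * z) *\<^sub>C vac"
    by (simp_all add: skew eval_nat_numeral ab ab0 nprod_scaleC_left vac_nprod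
        nprod_vac_creation translation_def)
  \<comment> \<open>The trailing 0 does not change the polynomial; it gives the cubic shape that the
    criterion expects.\<close>
  ultimately have "lambda_bracket b a = [:s *\<^sub>C (x - \<partial> y), - (s *\<^sub>C y), (s * z) *\<^sub>C vac, 0:]"
    unfolding lambda_bracket_eq_cubic_iff by simp
  then show ?thesis by simp
qed

section \<open>Deforming the superconformal vector\<close>

theorem proposition4p3:
  fixes G L v :: "'a::vertex_superalgebra" and c c\<^sub>1 c\<^sub>2 :: complex
  assumes "superconformal_vector c G"
    and "L = corresponding_conformal G"
    and "v \<in> homog 1"
    and "lambda_bracket L v = [:\<partial> v, (1 / 2) *\<^sub>C v:]"
    and "lambda_bracket G v = [:G \<cdot>\<^bsub>0\<^esub> v, c\<^sub>1 *\<^sub>C vac:]"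
    and "lambda_bracket v v = [:c\<^sub>2 *\<^sub>C vac:]"
    and "diagonalizable (\<lambda>a. (G \<cdot>\<^bsub>0\<^esub> v) \<cdot>\<^bsub>0\<^esub> a)"
  shows "superconformal_vector (c + 6 * c\<^sub>1 - 3 * c\<^sub>2) (G + \<partial> v) \<and>
    corresponding_conformal (G + \<partial> v) = L + (1 / 2) *\<^sub>C \<partial> (G \<cdot>\<^bsub>0\<^esub> v) \<and>
    conformal_vector (c + 6 * c\<^sub>1 - 3 * c\<^sub>2) (L + (1 / 2) *\<^sub>C \<partial> (G \<cdot>\<^bsub>0\<^esub> v))"
proof -
  define J where "J = G \<cdot>\<^bsub>0\<^esub> v"
  note v = assms(3)
  have G: "G \<in> homog 1" and LG: "lambda_bracket L G = [:\<partial> G, (3 / 2) *\<^sub>C G:]"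
    and GG: "lambda_bracket G G = [:2 *\<^sub>C L, 0, (c / 3) *\<^sub>C vac:]"
    and L: "L \<in> homog 0" and LL: "lambda_bracket L L = [:\<partial> L, 2 *\<^sub>C L, 0, (c / 12) *\<^sub>C vac:]"
    and L0: "\<And>a. L \<cdot>\<^bsub>0\<^esub> a = \<partial> a" and L1: "diagonalizable (\<lambda>a. L \<cdot>\<^bsub>1\<^esub> a)"
    using assms(1) unfolding superconformal_vector_def assms(2)[symmetric] Let_def
      conformal_vector_def by blast+
  have J: "J \<in> homog 0"
    using nprod_homog[OF G v] by (simp add: J_def)
  have Gv: "lambda_bracket G v = [:J, c\<^sub>1 *\<^sub>C vac:]"
    using assms(5) by (simp add: J_def)

  \<comment> \<open>Mode form of the given brackets\<close>
  have modes_LG: "L \<cdot>\<^bsub>0\<^esub> G = \<partial> G" "L \<cdot>\<^bsub>1\<^esub> G = (3 / 2) *\<^sub>C G" "\<And>n. n \<ge> 2 \<Longrightarrow> L \<cdot>\<^bsub>int n\<^esub> G = 0"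
    by (auto simp: nprod_eq_coeff[OF LG] coeff_pCons split: nat.split)
  have modes_GG: "G \<cdot>\<^bsub>0\<^esub> G = 2 *\<^sub>C L" "G \<cdot>\<^bsub>1\<^esub> G = 0" "G \<cdot>\<^bsub>2\<^esub> G = (2 * c / 3) *\<^sub>C vac"
      "\<And>n. n \<ge> 3 \<Longrightarrow> G \<cdot>\<^bsub>int n\<^esub> G = 0"
    by (auto simp: nprod_eq_coeff[OF GG] coeff_pCons numeral_2_eq_2 split: nat.split)
  have modes_Lv: "L \<cdot>\<^bsub>0\<^esub> v = \<partial> v" "L \<cdot>\<^bsub>1\<^esub> v = (1 / 2) *\<^sub>C v" "\<And>n. n \<ge> 2 \<Longrightarrow> L \<cdot>\<^bsub>int n\<^esub> v = 0"
    by (auto simp: nprod_eq_coeff[OF assms(4)] coeff_pCons split: nat.split)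
  have modes_Gv: "G \<cdot>\<^bsub>0\<^esub> v = J" "G \<cdot>\<^bsub>1\<^esub> v = c\<^sub>1 *\<^sub>C vac" "\<And>n. n \<ge> 2 \<Longrightarrow> G \<cdot>\<^bsub>int n\<^esub> v = 0"
    by (auto simp: nprod_eq_coeff[OF Gv] coeff_pCons split: nat.split)
  have modes_vv: "v \<cdot>\<^bsub>0\<^esub> v = c\<^sub>2 *\<^sub>C vac" "\<And>n. n \<ge> 1 \<Longrightarrow> v \<cdot>\<^bsub>int n\<^esub> v = 0"
    by (auto simp: nprod_eq_coeff[OF assms(6)] coeff_pCons split: nat.split)

  \<comment> \<open>Brackets of G, v and L with J\<close>
  have vG: "lambda_bracket v G = [:J, - (c\<^sub>1 *\<^sub>C vac):]"
    using lambda_bracket_skew_quadratic[OF G v, of J "c\<^sub>1 *\<^sub>C vac" 0 1] Gv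
    by (simp add: koszul_sign_def translation_scaleC)

  have vJ0: "v \<cdot>\<^bsub>int n\<^esub> J = 0" for n
  proof -
    have modes: "v \<cdot>\<^bsub>0\<^esub> G = J" "v \<cdot>\<^bsub>0\<^esub> (v \<cdot>\<^bsub>int n\<^esub> G) = (if n = 0 then v \<cdot>\<^bsub>0\<^esub> J else 0)"
      by (auto simp: nprod_eq_coeff[OF vG] coeff_pCons nprod_scaleC_right nprod_vac_nonneg
          split: nat.split)
    \<comment> \<open>The anticommutator of the modes n and 0 of \<open>v\<close> is a multiple of
      the mode n \<ge> 0 of \<open>vac\<close>, hence zero. At n = 0 both terms coincide and give
      twice the claim; for n > 0 the second vanishes.\<close>
    have "(v \<cdot>\<^bsub>int n\<^esub> J) + (v \<cdot>\<^bsub>0\<^esub> (v \<cdot>\<^bsub>int n\<^esub> G)) = 0"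
      using commutator_formula[OF v v, of 0 "int n" 0 G] modes_vv modes(1)
      by (simp add: koszul_sign_def nprod_scaleC_left vac_nprod)
    then show ?thesis
      using cvec.scale_left_distrib[of 1 1 "v \<cdot>\<^bsub>0\<^esub> J"]
      by (auto simp: modes(2) split: if_splits)
  qed
  then have vJ: "lambda_bracket v J = 0"
    by (simp add: lambda_bracket_eq_iff)
  have Jv: "lambda_bracket J v = 0"
    using lambda_bracket_skew_quadratic[OF v J, of 0 0 0] vJ by simp
  have GJ0: "G \<cdot>\<^bsub>int n\<^esub> J = (if n = 0 then \<partial> v else 2 *\<^sub>C (L \<cdot>\<^bsub>int n\<^esub> v))" for n
  proof -
    \<comment> \<open>The central term of {G_n, G_0} acts on \<open>v\<close> through the mode n - 2
      of \<open>vac\<close>. That mode is nonzero only at n = 1, where the binomial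
      vanishes.\<close>
    have "(of_nat n gchoose 2) *\<^sub>C (((2 * c / 3) *\<^sub>C vac) \<cdot>\<^bsub>int n - 2\<^esub> v) = 0"
      using binomial_gbinomial[of 1 2, where 'a=complex]
      by (cases "n = 1") (auto simp: nprod_scaleC_left vac_nprod numeral_2_eq_2)
    then have comm: "(G \<cdot>\<^bsub>int n\<^esub> J) + (G \<cdot>\<^bsub>0\<^esub> (G \<cdot>\<^bsub>int n\<^esub> v)) = 2 *\<^sub>C (L \<cdot>\<^bsub>int n\<^esub> v)"
      using commutator_formula[OF G G, of 2 "int n" 0 v] modes_GG
      by (simp add: koszul_sign_def nprod_scaleC_left numeral_2_eq_2 J_def)
    show ?thesis
    proof (cases "n = 0")
      case True
      then have "2 *\<^sub>C (G \<cdot>\<^bsub>0\<^esub> J) = 2 *\<^sub>C \<partial> v"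
        using comm cvec.scale_left_distrib[of 1 1 "G \<cdot>\<^bsub>0\<^esub> J"]
        by (simp add: modes_Gv modes_Lv)
      with True show ?thesis by simp
    next
      case False
      then have "G \<cdot>\<^bsub>0\<^esub> (G \<cdot>\<^bsub>int n\<^esub> v) = 0"
        using modes_Gv by (cases "n = 1") (simp_all add: nprod_scaleC_right nprod_vac_nonneg)
      with False comm show ?thesis by simp
    qed
  qed
  have GJ: "lambda_bracket G J = [:\<partial> v, v:]"
    unfolding lambda_bracket_eq_iff
  proof
    show "G \<cdot>\<^bsub>int n\<^esub> J = fact n *\<^sub>C coeff [:\<partial> v, v:] n" for n
      using modes_Lv by (cases "n \<ge> 2") (auto simp: GJ0 coeff_pCons less_2_cases_iff not_le
          split: nat.split)
  qed
  have JG: "lambda_bracket J G = [:0, v:]"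
    using lambda_bracket_skew_quadratic[OF G J, of "\<partial> v" v 0] GJ
    by (simp add: koszul_sign_def)
  have JJ0: "J \<cdot>\<^bsub>int n\<^esub> J = of_nat n *\<^sub>C (v \<cdot>\<^bsub>int n - 1\<^esub> v)" for n
  proof -
    have "J \<cdot>\<^bsub>0\<^esub> G = 0" "J \<cdot>\<^bsub>1\<^esub> G = v" "\<And>k. k > 1 \<Longrightarrow> J \<cdot>\<^bsub>int k\<^esub> G = 0"
      "J \<cdot>\<^bsub>int n\<^esub> v = 0"
      by (auto simp: nprod_eq_coeff[OF JG] nprod_eq_coeff[OF Jv] coeff_pCons split: nat.split)
    \<comment> \<open>Write the second \<open>J\<close> as the mode 0 of \<open>G\<close> on
      \<open>v\<close> and commute mode n of \<open>J\<close> past it. The remaining term vanishes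
      because [J \<lambda> v] = 0.\<close>
    then show ?thesis
      using commutator_formula[OF J G, of 1 "int n" 0 v] by (simp add: J_def)
  qed
  have JJ: "lambda_bracket J J = [:0, c\<^sub>2 *\<^sub>C vac:]"
    unfolding lambda_bracket_eq_iff
  proof
    show "J \<cdot>\<^bsub>int n\<^esub> J = fact n *\<^sub>C coeff [:0, c\<^sub>2 *\<^sub>C vac:] n" for n
      using modes_vv(1) modes_vv(2)[of "n - 1"]
      by (cases "n \<ge> 2") (auto simp: JJ0 coeff_pCons less_2_cases_iff not_le of_nat_diff
          split: nat.split)
  qed
  have LJ0: "L \<cdot>\<^bsub>int n\<^esub> J = (G \<cdot>\<^bsub>0\<^esub> (L \<cdot>\<^bsub>int n\<^esub> v)) + (of_nat n / 2) *\<^sub>C (G \<cdot>\<^bsub>int n - 1\<^esub> v)" for n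
  proof -
    let ?x = "G \<cdot>\<^bsub>int n - 1\<^esub> v"
    \<comment> \<open>In [L_n, G_0] the term \<partial> G contributes -n and the weight 3/2
      contributes 3n/2, leaving n/2.\<close>
    have "(L \<cdot>\<^bsub>int n\<^esub> J) - (G \<cdot>\<^bsub>0\<^esub> (L \<cdot>\<^bsub>int n\<^esub> v)) = - (of_nat n *\<^sub>C ?x) + (of_nat n * (3 / 2)) *\<^sub>C ?x"
      using commutator_formula[OF L G, of 1 "int n" 0 v] modes_LG
      by (simp add: koszul_sign_def nprod_scaleC_left translation_nprod J_def)
    also have "\<dots> = (- of_nat n + of_nat n * (3 / 2)) *\<^sub>C ?x"
      by (simp only: cvec.scale_left_distrib cvec.scale_minus_left)
    also have "- of_nat n + of_nat n * (3 / 2) = (of_nat n / 2 :: complex)"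
      by simp
    finally show ?thesis by (simp add: algebra_simps)
  qed
  have half: "(1 / 2) *\<^sub>C x + (1 / 2) *\<^sub>C x = x" for x :: 'a
    using cvec.scale_left_distrib[of "1 / 2" "1 / 2" x] by simp
  have LJ: "lambda_bracket L J = [:\<partial> J, J, (c\<^sub>1 / 2) *\<^sub>C vac:]"
  proof -
    have "L \<cdot>\<^bsub>1\<^esub> J = J"
      using LJ0[of 1] modes_Lv modes_Gv half by (simp add: nprod_scaleC_right)
    moreover have "L \<cdot>\<^bsub>2\<^esub> J = c\<^sub>1 *\<^sub>C vac"
      using LJ0[of 2] modes_Lv(3)[of 2] modes_Gv by simp
    moreover have "L \<cdot>\<^bsub>int n\<^esub> J = 0" if "n \<ge> 3" for n
      using that LJ0[of n] modes_Lv(3)[of n] modes_Gv(3)[of "n - 1"] by (simp add: of_nat_diff)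
    moreover from this[of 3] have "L \<cdot>\<^bsub>3\<^esub> J = 0" by simp
    ultimately have "lambda_bracket L J = [:\<partial> J, J, (c\<^sub>1 / 2) *\<^sub>C vac, 0:]"
      unfolding lambda_bracket_eq_cubic_iff by (simp add: L0)
    then show ?thesis by simp
  qed
  have JL: "lambda_bracket J L = [:0, J, - ((c\<^sub>1 / 2) *\<^sub>C vac):]"
    using lambda_bracket_skew_quadratic[OF L J LJ]
    by (simp add: koszul_sign_def)

  \<comment> \<open>Brackets of the deformed pair\<close>
  define c' where "c' = c + 6 * c\<^sub>1 - 3 * c\<^sub>2"
  define G' where "G' = G + \<partial> v"
  define L' where "L' = L + (1 / 2) *\<^sub>C \<partial> J"
  note bracket_simps = lambda_bracket_add_left lambda_bracket_add_right
    lambda_bracket_scaleC_left lambda_bracket_scaleC_right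
    lambda_bracket_translation_left lambda_bracket_translation_right
    map_poly_pCons translation_add translation_diff translation_scaleC cvec.scale_right_distrib
    cvec.scale_left_distrib cvec.scale_right_diff_distrib cvec.scale_left_diff_distrib
  \<comment> \<open>The \<lambda>^2 coefficient of [G' \<lambda> G']: each mixed bracket gives
    \<open>c\<^sub>1\<close>, and [\<partial>v \<lambda> \<partial>v] gives
    -\<open>c\<^sub>2\<close>. The mixed terms \<lambda> J cancel.\<close>
  have "(c' / 3) *\<^sub>C vac = (c / 3) *\<^sub>C vac + c\<^sub>1 *\<^sub>C vac + (c\<^sub>1 *\<^sub>C vac - c\<^sub>2 *\<^sub>C (vac :: 'a))"
    by (simp add: c'_def add_divide_distrib diff_divide_distrib
        flip: cvec.scale_left_distrib cvec.scale_left_diff_distrib)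
  then have G'G': "lambda_bracket G' G' = [:2 *\<^sub>C L', 0, (c' / 3) *\<^sub>C vac:]"
    unfolding G'_def L'_def
    by (simp add: bracket_simps GG vG Gv assms(6))
  \<comment> \<open>The term \<lambda>^2 v / 2 of [L \<lambda> \<partial>v] cancels against half of
    [\<partial>J \<lambda> G].\<close>
  have L'G': "lambda_bracket L' G' = [:\<partial> G', (3 / 2) *\<^sub>C G':]"
    unfolding G'_def L'_def
    using cvec.scale_left_distrib[of "1 / 2" 1 "\<partial> v"]
    by (simp add: bracket_simps LG JG Jv assms(4))
  \<comment> \<open>The \<lambda>^3 coefficient of [L' \<lambda> L']: \<open>c\<^sub>1 / 4\<close>
    from each mixed bracket, -\<open>c\<^sub>2 / 4\<close> from a quarter of
    [\<partial>J \<lambda> \<partial>J].\<close>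
  have "(c' / 12) *\<^sub>C vac =
      (c / 12) *\<^sub>C vac + (c\<^sub>1 / 4) *\<^sub>C vac + ((c\<^sub>1 / 4) *\<^sub>C vac - (c\<^sub>2 / 4) *\<^sub>C (vac :: 'a))"
    by (simp add: c'_def add_divide_distrib diff_divide_distrib
        flip: cvec.scale_left_distrib cvec.scale_left_diff_distrib)
  then have L'L': "lambda_bracket L' L' = [:\<partial> L', 2 *\<^sub>C L', 0, (c' / 12) *\<^sub>C vac:]"
    unfolding L'_def
    by (simp add: bracket_simps LL LJ JL JJ half)
  have L': "L' = corresponding_conformal G'"
    unfolding corresponding_conformal_def by (simp add: nprod_eq_coeff[OF G'G'])

  \<comment> \<open>Conformality of L' and diagonalizability of its first mode\<close>
  have "conformal_vector c' L'"
    unfolding conformal_vector_def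
  proof (intro conjI allI)
    show "L' \<in> homog 0"
      unfolding L'_def by (intro homog_add homog_scaleC translation_homog L J)
    show "L' \<cdot>\<^bsub>0\<^esub> a = \<partial> a" for a
      by (simp add: L'_def nprod_add_left nprod_scaleC_left translation_nprod L0)
    have modes_LJ: "L \<cdot>\<^bsub>0\<^esub> J = \<partial> J" "L \<cdot>\<^bsub>1\<^esub> J = J" "\<And>n. n > 2 \<Longrightarrow> L \<cdot>\<^bsub>int n\<^esub> J = 0"
      by (auto simp: nprod_eq_coeff[OF LJ] coeff_pCons split: nat.split)
    \<comment> \<open>In [L_1, J_0] the contribution of L_0 J = \<partial> J is -J_0 and that of L_1
      J = J is J_0. The central term carries the binomial (1 choose 2) = 0.\<close>
    have comm: "L \<cdot>\<^bsub>1\<^esub> (J \<cdot>\<^bsub>0\<^esub> x) = J \<cdot>\<^bsub>0\<^esub> (L \<cdot>\<^bsub>1\<^esub> x)" for x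
      using commutator_formula[OF L J, of 2 1 0 x] modes_LJ
        binomial_gbinomial[of 1 2, where 'a=complex]
      by (simp add: koszul_sign_def numeral_2_eq_2 translation_nprod)
    have "diagonalizable (\<lambda>a. (L \<cdot>\<^bsub>1\<^esub> a) - (1 / 2) *\<^sub>C (J \<cdot>\<^bsub>0\<^esub> a))"
      by (rule diagonalizable_diff_commuting[OF clinear_nprod L1 clinear_nprod _ comm])
        (use assms(7) J_def in simp)
    then show "diagonalizable (\<lambda>a. L' \<cdot>\<^bsub>1\<^esub> a)"
      by (simp add: L'_def nprod_add_left nprod_scaleC_left translation_nprod)
  qed (rule L'L')
  moreover have "G' \<in> homog 1"
    unfolding G'_def by (intro homog_add translation_homog G v)
  ultimately have "superconformal_vector c' G' \<and> corresponding_conformal G' = L' \<and>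
      conformal_vector c' L'"
    unfolding superconformal_vector_def Let_def L'[symmetric]
    using G'G' L'G' L'L' by blast
  then show ?thesis
    unfolding G'_def L'_def c'_def J_def .
qed

end
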